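(* Let a partially ordered integration structure be given with Riesz spaces $X,Y,Z$, $\mathcal H$ a $\sigma$-algebra of subsets of $\Omega$, integrals in $Z$ taken with respect to $(D)$-convergence, and $Z$ $\sigma$-Dedekind complete and weakly $\sigma$-distributive. Let $\mu:\mathcal H\to Y^+$ be finitely additive and let $\{f_n\}_{n\in\mathbb N}$ be an increasing sequence of functions $f_n:\Omega\to X$, net Riemann integrable with respect to $\mu$ on every set of $\mathcal H$. Suppose that: (a) the integration procedure satisfies the Henstock property; (b) $\{f_n\}$ has uniformly regulated net Riemann integrals; (c) $\{f_n\}$ has uniformly approximable integrals; (d) $f_n$ converges to $f:\Omega\to X$ with a common regulator; (e) for a fixed $A\in\mathcal H$, the sequence $\{\int_A f_n\,d\mu\}_{n\in\mathbb N}$ is bounded in $Z$. Then $f$ is net Riemann integrable and $$\int_A f\,d\mu=(o)\text{-}\lim_{n\to\infty}\int_A f_n\,d\mu=\bigvee_{n=1}^\infty\int_A f_n\,d\mu .$$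
   Context: A net convergence structure $\eta$ on a set $V$ assigns to each $v\in V$ a class of nets in $V$ ("converging to $v$") such that: (i) constant nets $v$ converge to $v$; (ii) every quasi-subnet of a net converging to $v$ converges to $v$, where $(y_j)_{j\in J}$ is a quasi-subnet of $(x_i)_{i\in I}$ if for every $i_0$ there is $j_0$ with $\{y_j:j\ge j_0\}\subseteq\{x_i:i\ge i_0\}$; (iii) if $(x_i)_{i\in I},(y_i)_{i\in I}$ converge to $v$ and $z_i\in\{x_i,y_i\}$ for all $i$, then $(z_i)$ converges to $v$. Standing assumptions: real vector spaces, Archimedean Riesz spaces, Hausdorff structures (unique limits), continuous addition and multiplication by fixed reals; on Riesz spaces the structure is locally solid: if $y_l\to0$ and $(x_i)$ is a net such that for every $l_0$ there is $i_0$ such that for every $i\ge i_0$ there is $l\ge l_0$ with $|x_i|\le|y_l|$, then $x_i\to 0$. A partially ordered integration structure consists of: a set $\Omega$ with a class $\mathcal H$ of subsets (here a $\sigma$-algebra); for each $A\in\mathcal H$ a net $\{(\sigma_\gamma,\tau_\gamma)\}_{\gamma\in\Gamma(A)}$, where $\Gamma(A)$ is a directed set and $\sigma_\gamma=\{\sigma_{\gamma_i}\}_{i\in I_\gamma}$, $\tau_\gamma=\{\tau_{\gamma_i}\}_{i\in I_\gamma}$ are finite families in $\mathcal H$ and $\Omega$ (the set $\sigma_{\gamma_i}$ is tagged by $\tau_{\gamma_i}$); Riesz spaces $(X,\eta_1),(Y,\eta_2),(Z,\eta_3)$ with net convergence structures; and a bilinear product $\bullet:X\times Y\to Z$ (juxtaposition),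 i.e. a bilinear map, continuous in each argument separately, isotone on $X^+\times Y^+$, with $\sup_n(x_n\bullet y)=(\sup_n x_n)\bullet y$ and $\sup_n(x\bullet y_n)=x\bullet(\sup_n y_n)$ for $x\in X^+$, $y\in Y^+$ and nonnegative sequences whose suprema exist. The net Riemann integral is $\int_A f\,d\mu=\lim_{\gamma\in\Gamma(A)}\sum_{i\in I_\gamma}f(\tau_{\gamma_i})\mu(\sigma_{\gamma_i})$ when the limit exists; $f$ is net Riemann integrable if this holds for every set in $\mathcal H$. Convention: the nets consist of sets such that $\sum_{i\in I_\gamma}\mu(\sigma_{\gamma_i})=\mu(\bigcup_{i\in I_\gamma}\sigma_{\gamma_i})$ for $\mu$ finitely additive. A $(D)$-sequence (regulator) is a double sequence $\{a_{ij}\}$ with $a_{ij}\ge a_{i,j+1}$ and $\bigwedge_j a_{ij}=0$ for all $i$. A net $(x_i)$ $(D)$-converges to $x$ if there is a $(D)$-sequence such that for every $\varphi\in\mathbb N^{\mathbb N}$ there is $i_0$ with $|x_i-x|\le\bigvee_{j}a_{j\varphi(j)}$ for $i\ge i_0$ (suprema understood to exist). $Z$ is weakly $\sigma$-distributive if $\bigwedge_{\varphi}\bigvee_i a_{i\varphi(i)}=0$ for every $(D)$-sequence; $\sigma$-Dedekind complete if every countable set bounded above has a supremum. $(o)$-$\lim z_n=z$ means $|z_n-z|\le w_n$ for some $w_n\downarrow0$. Common regulator: there is a $(D)$-sequence $\{a_{ij}\}$ in $X$ such that for every $\varphi$ and $\omega\in\Omega$ there is $p(\omega)$ with $|f_n(\omega)-f(\omega)|\le\bigvee_i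 a_{i\varphi(i)}$ for $n\ge p(\omega)$. Uniformly regulated integrals: there is a nonnegative triple sequence $\{a_{nij}\}$ in $Z$ such that $\{a_{nij}\}_{ij}$ is bounded for every $n$ and $a_{nij}\downarrow0$ as $j\to\infty$; $\big\{\sum_{n=1}^m\bigvee_i a_{ni\varphi(i+n+1)}\big\}_{m}$ is bounded in $Z$ for every $\varphi\in\mathbb N^{\mathbb N}$; and for every $\varphi$, $n$ and $A\in\mathcal H$ there is $\gamma_n\in\Gamma(A)$ with $\big|\int_A f_n\,d\mu-\sum_{i\in I_\gamma}f_n(\tau_{\gamma_i})\mu(\sigma_{\gamma_i})\big|\le\bigvee_i a_{ni\varphi(i+n+1)}$ for each $\gamma\ge\gamma_n$. Uniformly approximable integrals: there is a $(D)$-sequence $\{b_{ij}\}$ in $Z$ such that for every $A\in\mathcal H$ and $\varphi$ there is $\gamma_0\in\Gamma(A)$ with $\big|\int_A f_n\,d\mu-\sum_{i\in I_\gamma}f_n(\tau_{\gamma_i})\mu(\sigma_{\gamma_i})\big|\le\bigvee_i b_{i\varphi(i)}$ for all $\gamma\ge\gamma_0$ and all $n$. Henstock property (for integrable $g$, here applied to each $f_n$): (H1) if $g$ is integrable on $B\in\mathcal H$ it is integrable on every $A\subseteq B$, $A\in\mathcal H$; (H2) the integral of $g$ is additive (even for non-disjoint sets) on the sets forming $\sigma_\gamma$, $\gamma\in\Gamma(B)$, for each $B$ on which $g$ is integrable; (H3) for such $B$ and $\gamma\in\Gamma(B)$, the sets of $\sigma_\gamma$ have union $B$; (H4) if $g$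 is integrable on $B$ and $\{B_j\}_{j=1}^n$ are the sets of some $\gamma\in\Gamma(B)$, then for each $J\subseteq\{1,\dots,n\}$ and $\gamma^0\in\Gamma(\bigcup_{j\in J}B_j)$ there are $\gamma^*\ge\gamma^0$ in $\Gamma(\bigcup_{j\in J}B_j)$ and $\gamma^{(B)}\ge\gamma$ in $\Gamma(B)$ such that the tagged family of $\gamma^{(B)}$ is that of $\gamma^*$ together with the sets $B_k$, $k\notin J$, tagged as in $\gamma$. Alternatively, (H2) may be replaced by finite additivity of the integral and (H4) by: (H4') if $\{B_j\}_{j=1}^n$ are the sets of some $\gamma\in\Gamma(B)$, $J\subseteq\{1,\dots,n\}$ and $F=B\setminus\bigcup_{j\in J}B_j$, then given $\gamma_0^{(F)}\in\Gamma(F)$ and $\gamma_0^{(B)}\in\Gamma(B)$ in the integrability definitions of $g$ on $F$ and on $B$, there are $\gamma_{00}^{(F)}\in\Gamma(F)$ and $\gamma_{00}^{(B)}\ge\gamma_0^{(B)}$ in $\Gamma(B)$ such that the tagged family of $\gamma_{00}^{(B)}$ is that of $\gamma_{00}^{(F)}$ together with the tagged sets $B_j$, $j\in J$. *)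

theory Defs
  imports
    "HOL-Analysis.Analysis"
    "HOL-Library.Lattice_Algebras"
    "HOL-Library.Lub_Glb"
    "HOL-Library.Multiset"
begin

section \<open>Riesz spaces\<close>

class archimedean_riesz_space = ordered_real_vector + lattice_ab_group_add_abs +
  assumes archimedean: "(\<And>n::nat. real n *\<^sub>R x \<le> y) \<Longrightarrow> x \<le> 0"

instance real :: archimedean_riesz_space
proof
  fix x y :: real
  assume bound: "\<And>n::nat. real n *\<^sub>R x \<le> y"
  show "x \<le> 0"
  proof (rule ccontr)
    assume "\<not> x \<le> 0"
    then obtain n :: nat where "y < real n * x"
      using reals_Archimedean3[of x] by auto
    with bound[of n] show False by simp
  qed
qed

definition order_bounded :: "'a::order set \<Rightarrow> bool" where
  "order_bounded C \<longleftrightarrow> bdd_above C \<and> bdd_below C"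

definition sigma_dedekind_complete :: "'z::order itself \<Rightarrow> bool" where
  "sigma_dedekind_complete _ \<longleftrightarrow>
     (\<forall>C::'z set. countable C \<and> C \<noteq> {} \<and> bdd_above C \<longrightarrow> (\<exists>s. isLub UNIV C s))"

definition D_sequence :: "(nat \<Rightarrow> nat \<Rightarrow> 'a::archimedean_riesz_space) \<Rightarrow> bool" where
  "D_sequence a \<longleftrightarrow>
     (\<forall>i j. a i (Suc j) \<le> a i j) \<and> (\<forall>i. isGlb UNIV (range (a i)) 0)"

text \<open>The supremum of the \<open>a i (\<phi> i)\<close> need not exist for an arbitrary (D)-sequence. Throughout,
  such suprema are named by a variable constrained by this predicate, so that their
  existence is part of each condition in which they occur.\<close>

definition D_sup :: "(nat \<Rightarrow> nat \<Rightarrow> 'a::archimedean_riesz_space) \<Rightarrow> (nat \<Rightarrow> nat) \<Rightarrow> 'a \<Rightarrow> bool" where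
  "D_sup a \<phi> s \<longleftrightarrow> isLub UNIV (range (\<lambda>i. a i (\<phi> i))) s"

definition weakly_sigma_distributive :: "'z::archimedean_riesz_space itself \<Rightarrow> bool" where
  "weakly_sigma_distributive _ \<longleftrightarrow>
     (\<forall>(a :: nat \<Rightarrow> nat \<Rightarrow> 'z) S.
        D_sequence a \<and> (\<forall>\<phi>. D_sup a \<phi> (S \<phi>)) \<longrightarrow> isGlb UNIV (range S) 0)"

definition o_lim :: "(nat \<Rightarrow> 'a::archimedean_riesz_space) \<Rightarrow> 'a \<Rightarrow> bool" where
  "o_lim z l \<longleftrightarrow>
     (\<exists>w. decseq w \<and> isGlb UNIV (range w) 0 \<and> (\<forall>n. \<bar>z n - l\<bar> \<le> w n))"


section \<open>Net convergence structures\<close>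

definition directed_set :: "'i set \<Rightarrow> ('i \<Rightarrow> 'i \<Rightarrow> bool) \<Rightarrow> bool" where
  "directed_set D le \<longleftrightarrow>
     D \<noteq> {} \<and> reflp_on D le \<and> transp_on D le \<and>
     (\<forall>i\<in>D. \<forall>j\<in>D. \<exists>k\<in>D. le i k \<and> le j k)"

text \<open>A net is a directed set \<open>(D, le)\<close> inside the index type \<open>'i\<close> together with a function
  \<open>x\<close> that matters only on \<open>D\<close>; \<open>\<eta> D le x v\<close> says that this net converges to \<open>v\<close>. HOL cannot
  quantify over all types inside a formula, so \<open>'i\<close> serves as the (arbitrary) universe of indices.\<close>

type_synonym ('i, 'v) net_convergence = "'i set \<Rightarrow> ('i \<Rightarrow> 'i \<Rightarrow> bool) \<Rightarrow> ('i \<Rightarrow> 'v) \<Rightarrow> 'v \<Rightarrow> bool"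

definition net_tail :: "'i set \<Rightarrow> ('i \<Rightarrow> 'i \<Rightarrow> bool) \<Rightarrow> ('i \<Rightarrow> 'v) \<Rightarrow> 'i \<Rightarrow> 'v set" where
  "net_tail D le x i0 = x ` {i \<in> D. le i0 i}"

definition quasi_subnet ::
  "'j set \<Rightarrow> ('j \<Rightarrow> 'j \<Rightarrow> bool) \<Rightarrow> ('j \<Rightarrow> 'v) \<Rightarrow> 'i set \<Rightarrow> ('i \<Rightarrow> 'i \<Rightarrow> bool) \<Rightarrow> ('i \<Rightarrow> 'v) \<Rightarrow> bool" where
  "quasi_subnet E leE y D leD x \<longleftrightarrow>
     (\<forall>i0\<in>D. \<exists>j0\<in>E. net_tail E leE y j0 \<subseteq> net_tail D leD x i0)"

locale net_convergence_structure =
  fixes \<eta> :: "('i, 'v) net_convergence"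
  assumes constant_net: "directed_set D le \<Longrightarrow> \<eta> D le (\<lambda>_. v) v"
    and quasi_subnet_closed:
      "\<lbrakk>directed_set D leD; directed_set E leE; quasi_subnet E leE y D leD x; \<eta> D leD x v\<rbrakk>
        \<Longrightarrow> \<eta> E leE y v"
    and mixing:
      "\<lbrakk>directed_set D le; \<eta> D le x v; \<eta> D le y v; \<And>i. i \<in> D \<Longrightarrow> z i \<in> {x i, y i}\<rbrakk>
        \<Longrightarrow> \<eta> D le z v"

locale riesz_net_convergence = net_convergence_structure \<eta>
  for \<eta> :: "('i, 'v::archimedean_riesz_space) net_convergence" +
  assumes hausdorff: "\<lbrakk>directed_set D le; \<eta> D le x u; \<eta> D le x v\<rbrakk> \<Longrightarrow> u = v"
    and add_continuous:
      "\<lbrakk>directed_set D le; \<eta> D le x u; \<eta> D le y v\<rbrakk> \<Longrightarrow> \<eta> D le (\<lambda>i. x i + y i) (u + v)"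
    and scaleR_continuous:
      "\<lbrakk>directed_set D le; \<eta> D le x u\<rbrakk> \<Longrightarrow> \<eta> D le (\<lambda>i. c *\<^sub>R x i) (c *\<^sub>R u)"
    and locally_solid:
      "\<lbrakk>directed_set L leL; directed_set D leD; \<eta> L leL y 0;
        \<forall>l0\<in>L. \<exists>i0\<in>D. \<forall>i\<in>D. leD i0 i \<longrightarrow> (\<exists>l\<in>L. leL l0 l \<and> \<bar>x i\<bar> \<le> \<bar>y l\<bar>)\<rbrakk>
        \<Longrightarrow> \<eta> D leD x 0"

definition D_regulates ::
  "(nat \<Rightarrow> nat \<Rightarrow> 'v) \<Rightarrow> 'i set \<Rightarrow> ('i \<Rightarrow> 'i \<Rightarrow> bool) \<Rightarrow> ('i \<Rightarrow> 'v::archimedean_riesz_space) \<Rightarrow> 'v \<Rightarrow> bool" where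
  "D_regulates a D le x v \<longleftrightarrow>
     D_sequence a \<and>
     (\<forall>\<phi>. \<exists>s. D_sup a \<phi> s \<and> (\<exists>i0\<in>D. \<forall>i\<in>D. le i0 i \<longrightarrow> \<bar>x i - v\<bar> \<le> s))"

definition D_conv :: "('i, 'v::archimedean_riesz_space) net_convergence" where
  "D_conv D le x v \<longleftrightarrow> (\<exists>a. D_regulates a D le x v)"


section \<open>Partially ordered integration structures\<close>

text \<open>For each measurable \<open>A\<close>: the directed set \<open>\<Gamma>(A)\<close> with its order, and for each of its
  elements \<open>\<gamma>\<close> the finite index set \<open>I\<^sub>\<gamma>\<close> and the families of sets and tags over it.\<close>

record ('w, 'i, 'k) tagged_nets =
  Gam :: "'w set \<Rightarrow> 'i set"
  leq :: "'w set \<Rightarrow> 'i \<Rightarrow> 'i \<Rightarrow> bool"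
  idx :: "'w set \<Rightarrow> 'i \<Rightarrow> 'k set"
  pset :: "'w set \<Rightarrow> 'i \<Rightarrow> 'k \<Rightarrow> 'w set"
  ptag :: "'w set \<Rightarrow> 'i \<Rightarrow> 'k \<Rightarrow> 'w"

definition tagged_family ::
  "('w, 'i, 'k) tagged_nets \<Rightarrow> 'w set \<Rightarrow> 'i \<Rightarrow> 'k set \<Rightarrow> ('w set \<times> 'w) multiset" where
  "tagged_family N A \<gamma> J = image_mset (\<lambda>k. (pset N A \<gamma> k, ptag N A \<gamma> k)) (mset_set J)"

locale po_integration_structure =
  sigma_algebra \<Omega> \<H> +
  eta1: riesz_net_convergence \<eta>1 +
  eta2: riesz_net_convergence \<eta>2 +
  eta3: riesz_net_convergence \<eta>3
  for \<Omega> :: "'w set"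
    and \<H> :: "'w set set"
    and N :: "('w, 'i, 'k) tagged_nets"
    and \<eta>1 :: "('i, 'x::archimedean_riesz_space) net_convergence"
    and \<eta>2 :: "('i, 'y::archimedean_riesz_space) net_convergence"
    and \<eta>3 :: "('i, 'z::archimedean_riesz_space) net_convergence"
    and prd :: "'x \<Rightarrow> 'y \<Rightarrow> 'z" +
  assumes directed_Gam: "A \<in> \<H> \<Longrightarrow> directed_set (Gam N A) (leq N A)"
    and finite_idx: "\<lbrakk>A \<in> \<H>; \<gamma> \<in> Gam N A\<rbrakk> \<Longrightarrow> finite (idx N A \<gamma>)"
    and pset_in: "\<lbrakk>A \<in> \<H>; \<gamma> \<in> Gam N A; k \<in> idx N A \<gamma>\<rbrakk> \<Longrightarrow> pset N A \<gamma> k \<in> \<H>"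
    and ptag_in: "\<lbrakk>A \<in> \<H>; \<gamma> \<in> Gam N A; k \<in> idx N A \<gamma>\<rbrakk> \<Longrightarrow> ptag N A \<gamma> k \<in> \<Omega>"
    and bilinear_prd: "bilinear prd"
    and continuous_left:
      "\<lbrakk>directed_set D le; \<eta>1 D le x u\<rbrakk> \<Longrightarrow> \<eta>3 D le (\<lambda>i. prd (x i) y) (prd u y)"
    and continuous_right:
      "\<lbrakk>directed_set D le; \<eta>2 D le y' v\<rbrakk> \<Longrightarrow> \<eta>3 D le (\<lambda>i. prd u (y' i)) (prd u v)"
    and isotone_prd:
      "\<lbrakk>0 \<le> u; u \<le> u'; 0 \<le> v; v \<le> v'\<rbrakk> \<Longrightarrow> prd u v \<le> prd u' v'"
    and sup_left:
      "\<lbrakk>\<And>n::nat. 0 \<le> us n; 0 \<le> v; isLub UNIV (range us) u\<rbrakk>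
        \<Longrightarrow> isLub UNIV (range (\<lambda>n. prd (us n) v)) (prd u v)"
    and sup_right:
      "\<lbrakk>0 \<le> u; \<And>n::nat. 0 \<le> vs n; isLub UNIV (range vs) v\<rbrakk>
        \<Longrightarrow> isLub UNIV (range (\<lambda>n. prd u (vs n))) (prd u v)"

definition riemann_sum ::
  "('w, 'i, 'k) tagged_nets \<Rightarrow> ('x \<Rightarrow> 'y \<Rightarrow> 'z::comm_monoid_add) \<Rightarrow> ('w set \<Rightarrow> 'y) \<Rightarrow> ('w \<Rightarrow> 'x) \<Rightarrow>
     'w set \<Rightarrow> 'i \<Rightarrow> 'z" where
  "riemann_sum N prd \<mu> g A \<gamma> = (\<Sum>k\<in>idx N A \<gamma>. prd (g (ptag N A \<gamma> k)) (\<mu> (pset N A \<gamma> k)))"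

definition has_net_integral where
  "has_net_integral N \<eta>3 prd \<mu> g A z \<longleftrightarrow>
     \<eta>3 (Gam N A) (leq N A) (riemann_sum N prd \<mu> g A) z"

definition net_integrable_on where
  "net_integrable_on N \<eta>3 prd \<mu> g A \<longleftrightarrow> (\<exists>z. has_net_integral N \<eta>3 prd \<mu> g A z)"

definition net_integral where
  "net_integral N \<eta>3 prd \<mu> g A = (THE z. has_net_integral N \<eta>3 prd \<mu> g A z)"

definition net_riemann_integrable where
  "net_riemann_integrable \<H> N \<eta>3 prd \<mu> g \<longleftrightarrow> (\<forall>A\<in>\<H>. net_integrable_on N \<eta>3 prd \<mu> g A)"

definition measure_adapted ::
  "'w set set \<Rightarrow> ('w, 'i, 'k) tagged_nets \<Rightarrow> ('w set \<Rightarrow> 'y::comm_monoid_add) \<Rightarrow> bool" where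
  "measure_adapted \<H> N \<mu> \<longleftrightarrow>
     (\<forall>A\<in>\<H>. \<forall>\<gamma>\<in>Gam N A.
        (\<Sum>k\<in>idx N A \<gamma>. \<mu> (pset N A \<gamma> k)) = \<mu> (\<Union>k\<in>idx N A \<gamma>. pset N A \<gamma> k))"


section \<open>The Henstock property\<close>

text \<open>\<open>\<gamma>0\<close> is an element of \<open>\<Gamma>(A)\<close> that occurs in the definition of (D)-integrability of \<open>g\<close> on
  \<open>A\<close>, i.e. one provided for some \<open>\<phi>\<close> by some regulator of the integral.\<close>

definition integrability_stage where
  "integrability_stage N prd \<mu> g A \<gamma>0 \<longleftrightarrow>
     \<gamma>0 \<in> Gam N A \<and>
     (\<exists>a \<phi> s. D_regulates a (Gam N A) (leq N A) (riemann_sum N prd \<mu> g A)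
                (net_integral N D_conv prd \<mu> g A) \<and>
        D_sup a \<phi> s \<and>
        (\<forall>\<gamma>\<in>Gam N A. leq N A \<gamma>0 \<gamma> \<longrightarrow>
           \<bar>riemann_sum N prd \<mu> g A \<gamma> - net_integral N D_conv prd \<mu> g A\<bar> \<le> s))"

definition henstock_H1 where
  "henstock_H1 \<H> N prd \<mu> g \<longleftrightarrow>
     (\<forall>B\<in>\<H>. net_integrable_on N D_conv prd \<mu> g B \<longrightarrow>
        (\<forall>A\<in>\<H>. A \<subseteq> B \<longrightarrow> net_integrable_on N D_conv prd \<mu> g A))"

definition henstock_H2 where
  "henstock_H2 \<H> N prd \<mu> g \<longleftrightarrow>
     (\<forall>B\<in>\<H>. net_integrable_on N D_conv prd \<mu> g B \<longrightarrow>
        (\<forall>\<gamma>\<in>Gam N B. \<forall>J\<subseteq>idx N B \<gamma>.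
           net_integral N D_conv prd \<mu> g (\<Union>j\<in>J. pset N B \<gamma> j) =
           (\<Sum>j\<in>J. net_integral N D_conv prd \<mu> g (pset N B \<gamma> j))))"

definition henstock_H2' where
  "henstock_H2' \<H> N prd \<mu> g \<longleftrightarrow>
     (\<forall>C\<in>\<H>. \<forall>D\<in>\<H>. C \<inter> D = {} \<and> net_integrable_on N D_conv prd \<mu> g (C \<union> D) \<longrightarrow>
        net_integral N D_conv prd \<mu> g (C \<union> D) =
        net_integral N D_conv prd \<mu> g C + net_integral N D_conv prd \<mu> g D)"

definition henstock_H3 where
  "henstock_H3 \<H> N prd \<mu> g \<longleftrightarrow>
     (\<forall>B\<in>\<H>. net_integrable_on N D_conv prd \<mu> g B \<longrightarrow>
        (\<forall>\<gamma>\<in>Gam N B. (\<Union>k\<in>idx N B \<gamma>. pset N B \<gamma> k) = B))"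

definition henstock_H4 where
  "henstock_H4 \<H> N prd \<mu> g \<longleftrightarrow>
     (\<forall>B\<in>\<H>. net_integrable_on N D_conv prd \<mu> g B \<longrightarrow>
        (\<forall>\<gamma>\<in>Gam N B. \<forall>J\<subseteq>idx N B \<gamma>.
           let U = (\<Union>j\<in>J. pset N B \<gamma> j) in
           \<forall>\<gamma>0\<in>Gam N U. \<exists>\<gamma>s\<in>Gam N U. \<exists>\<gamma>B\<in>Gam N B.
             leq N U \<gamma>0 \<gamma>s \<and> leq N B \<gamma> \<gamma>B \<and>
             tagged_family N B \<gamma>B (idx N B \<gamma>B) =
               tagged_family N U \<gamma>s (idx N U \<gamma>s) + tagged_family N B \<gamma> (idx N B \<gamma> - J)))"

definition henstock_H4' where
  "henstock_H4' \<H> N prd \<mu> g \<longleftrightarrow>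
     (\<forall>B\<in>\<H>. net_integrable_on N D_conv prd \<mu> g B \<longrightarrow>
        (\<forall>\<gamma>\<in>Gam N B. \<forall>J\<subseteq>idx N B \<gamma>.
           let F = B - (\<Union>j\<in>J. pset N B \<gamma> j) in
           \<forall>\<gamma>0F \<gamma>0B.
             integrability_stage N prd \<mu> g F \<gamma>0F \<and> integrability_stage N prd \<mu> g B \<gamma>0B \<longrightarrow>
             (\<exists>\<gamma>F\<in>Gam N F. \<exists>\<gamma>B\<in>Gam N B.
                leq N B \<gamma>0B \<gamma>B \<and>
                tagged_family N B \<gamma>B (idx N B \<gamma>B) =
                  tagged_family N F \<gamma>F (idx N F \<gamma>F) + tagged_family N B \<gamma> J)))"

definition henstock_property where
  "henstock_property \<H> N prd \<mu> g \<longleftrightarrow>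
     henstock_H1 \<H> N prd \<mu> g \<and> henstock_H3 \<H> N prd \<mu> g \<and>
     ((henstock_H2 \<H> N prd \<mu> g \<and> henstock_H4 \<H> N prd \<mu> g) \<or>
      (henstock_H2' \<H> N prd \<mu> g \<and> henstock_H4' \<H> N prd \<mu> g))"


section \<open>Conditions on sequences of functions\<close>

definition common_regulator ::
  "'w set \<Rightarrow> (nat \<Rightarrow> 'w \<Rightarrow> 'x::archimedean_riesz_space) \<Rightarrow> ('w \<Rightarrow> 'x) \<Rightarrow> bool" where
  "common_regulator \<Omega> f f' \<longleftrightarrow>
     (\<exists>a. D_sequence a \<and>
        (\<forall>\<phi>. \<exists>s. D_sup a \<phi> s \<and> (\<forall>\<omega>\<in>\<Omega>. \<exists>p. \<forall>n\<ge>p. \<bar>f n \<omega> - f' \<omega>\<bar> \<le> s)))"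

text \<open>Sequences are indexed from 0. In the next definition this changes the shift \<open>i + n + 1\<close>
  only up to a translation of \<open>\<phi>\<close>, which is arbitrary.\<close>

definition uniformly_regulated_integrals where
  "uniformly_regulated_integrals \<H> N prd \<mu> f \<longleftrightarrow>
     (\<exists>a :: nat \<Rightarrow> nat \<Rightarrow> nat \<Rightarrow> 'z::archimedean_riesz_space.
        (\<forall>n i j. 0 \<le> a n i j) \<and>
        (\<forall>n. order_bounded (range (\<lambda>(i, j). a n i j))) \<and>
        (\<forall>n. D_sequence (a n)) \<and>
        (\<forall>\<phi>. \<exists>s.
           (\<forall>n. D_sup (a n) (\<lambda>i. \<phi> (i + n + 1)) (s n)) \<and>
           order_bounded (range (\<lambda>m. \<Sum>n<m. s n)) \<and>
           (\<forall>n. \<forall>A\<in>\<H>. \<exists>\<gamma>n\<in>Gam N A. \<forall>\<gamma>\<in>Gam N A. leq N A \<gamma>n \<gamma> \<longrightarrow>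
              \<bar>net_integral N D_conv prd \<mu> (f n) A - riemann_sum N prd \<mu> (f n) A \<gamma>\<bar> \<le> s n)))"

definition uniformly_approximable_integrals where
  "uniformly_approximable_integrals \<H> N prd \<mu> f \<longleftrightarrow>
     (\<exists>b :: nat \<Rightarrow> nat \<Rightarrow> 'z::archimedean_riesz_space.
        D_sequence b \<and>
        (\<forall>A\<in>\<H>. \<forall>\<phi>. \<exists>s. D_sup b \<phi> s \<and>
           (\<exists>\<gamma>0\<in>Gam N A. \<forall>\<gamma>\<in>Gam N A. leq N A \<gamma>0 \<gamma> \<longrightarrow>
              (\<forall>n::nat. \<bar>net_integral N D_conv prd \<mu> (f n) A
                        - riemann_sum N prd \<mu> (f n) A \<gamma>\<bar> \<le> s))))"

end

theory Submission
  imports Defs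
begin

text \<open>
  Uniform approximability makes the theorem an exchange of two suprema. Let \<open>b\<close> be the regulator
  that it provides, and write \<open>s(\<phi>)\<close> for the supremum over \<open>i\<close> of \<open>b i (\<phi> i)\<close>. For a partition
  \<open>\<gamma>\<close> of \<open>B\<close> that is late enough for \<open>\<phi>\<close>, the integral over \<open>B\<close> and the Riemann sum
  \<open>S(f\<^sub>n, \<gamma>)\<close> differ by at most \<open>s(\<phi>)\<close>, for all \<open>n\<close> at once. If the sums \<open>S(f\<^sub>n, \<gamma>)\<close> have the
  supremum \<open>S(f, \<gamma>)\<close>, then the integrals of the \<open>f\<^sub>n\<close> over \<open>B\<close> are bounded above by
  \<open>S(f, \<gamma>) + s(\<phi>)\<close>, so their supremum \<open>z\<close> exists, and taking suprema over \<open>n\<close> gives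
  \<open>\<bar>z - S(f, \<gamma>)\<bar> \<le> s(\<phi>)\<close>: the same regulator \<open>b\<close> shows that \<open>f\<close> has the integral \<open>z\<close> over
  \<open>B\<close> (lemma \<open>regulates_Lub\<close>). The supremum is also the \<open>(o)\<close>-limit because the integrals
  increase with \<open>n\<close>: the Riemann sums do, and weak \<open>\<sigma>\<close>-distributivity of \<open>Z\<close> makes the errors
  \<open>s(\<phi>)\<close> vanish in the infimum (lemma \<open>le_of_uniform_D_approximation\<close>).

  The delicate point is that \<open>S(f\<^sub>n, \<gamma>)\<close> increases to \<open>S(f, \<gamma>)\<close>. The space \<open>X\<close> may fail to
  be weakly \<open>\<sigma>\<close>-distributive, so a common regulator need not determine the limit in \<open>X\<close>, and
  \<open>f\<close> need not be the supremum of the \<open>f\<^sub>n\<close>. However, multiplication by \<open>\<mu>(E)\<close> preserves the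
  suprema of all nonnegative sequences, monotone or not. It therefore carries a regulator of
  \<open>X\<close>, together with its suprema along all \<open>\<phi>\<close>, to a regulator of \<open>Z\<close>, where weak
  \<open>\<sigma>\<close>-distributivity does identify the limit (lemma \<open>Lub_image_of_D_limit\<close>).
\<close>


section \<open>Suprema and infima of sequences\<close>

lemma isLub_range_iff:
  "isLub UNIV (range x) l \<longleftrightarrow> (\<forall>n. x n \<le> l) \<and> (\<forall>u. (\<forall>n. x n \<le> u) \<longrightarrow> l \<le> u)"
  unfolding isLub_def leastP_def isUb_def setle_def setge_def by auto

lemma isGlb_range_iff:
  "isGlb UNIV (range x) l \<longleftrightarrow> (\<forall>n. l \<le> x n) \<and> (\<forall>u. (\<forall>n. u \<le> x n) \<longrightarrow> u \<le> l)"
  unfolding isGlb_def greatestP_def isLb_def setle_def setge_def by auto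

lemma isLub_range_diff_iff_isGlb:
  fixes x :: "nat \<Rightarrow> 'a::ordered_ab_group_add"
  shows "isLub UNIV (range (\<lambda>n. c - x n)) c \<longleftrightarrow> isGlb UNIV (range x) 0"
proof
  assume L: "isLub UNIV (range (\<lambda>n. c - x n)) c"
  show "isGlb UNIV (range x) 0"
    unfolding isGlb_range_iff
  proof (intro conjI allI impI)
    show "0 \<le> x n" for n
      using L unfolding isLub_range_iff by (simp add: diff_le_eq)
    fix u assume "\<forall>n. u \<le> x n"
    then have "\<forall>n. c - x n \<le> c - u"
      by (simp add: diff_left_mono)
    then have "c \<le> c - u"
      using L unfolding isLub_range_iff by blast
    then show "u \<le> 0"
      by (simp add: le_diff_eq)
  qed
next
  assume G: "isGlb UNIV (range x) 0"
  show "isLub UNIV (range (\<lambda>n. c - x n)) c"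
    unfolding isLub_range_iff
  proof (intro conjI allI impI)
    show "c - x n \<le> c" for n
      using G unfolding isGlb_range_iff by (simp add: diff_le_eq)
    fix u assume "\<forall>n. c - x n \<le> u"
    then have "\<forall>n. c - u \<le> x n"
      by (metis add.commute diff_le_eq)
    then have "c - u \<le> 0"
      using G unfolding isGlb_range_iff by blast
    then show "c \<le> u"
      by simp
  qed
qed

lemma isLub_range_add:
  fixes x y :: "nat \<Rightarrow> 'a::ordered_ab_group_add"
  assumes "mono x" "mono y"
    and x: "isLub UNIV (range x) l" and y: "isLub UNIV (range y) k"
  shows "isLub UNIV (range (\<lambda>n. x n + y n)) (l + k)"
  unfolding isLub_range_iff
proof (intro conjI allI impI)
  show "x n + y n \<le> l + k" for n
    using x y unfolding isLub_range_iff by (simp add: add_mono)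
  fix u assume u: "\<forall>n. x n + y n \<le> u"
  \<comment> \<open>Monotonicity decouples the two indices.\<close>
  have "x m + y n \<le> u" for m n
  proof -
    have "x m + y n \<le> x (max m n) + y (max m n)"
      using assms(1,2) by (intro add_mono monoD[of x] monoD[of y]) auto
    also have "\<dots> \<le> u"
      using u by blast
    finally show ?thesis .
  qed
  then have "\<forall>m. x m \<le> u - y n" for n
    by (simp add: le_diff_eq)
  then have "l \<le> u - y n" for n
    using x unfolding isLub_range_iff by blast
  then have "\<forall>n. y n \<le> u - l"
    by (simp add: le_diff_eq add.commute)
  then have "k \<le> u - l"
    using y unfolding isLub_range_iff by blast
  then show "l + k \<le> u"
    by (simp add: le_diff_eq add.commute)
qed

lemma isLub_range_sum:
  fixes x :: "'k \<Rightarrow> nat \<Rightarrow> 'a::ordered_ab_group_add"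
  assumes "finite K"
    and "\<And>k. k \<in> K \<Longrightarrow> mono (x k)"
    and "\<And>k. k \<in> K \<Longrightarrow> isLub UNIV (range (x k)) (l k)"
  shows "isLub UNIV (range (\<lambda>n. \<Sum>k\<in>K. x k n)) (\<Sum>k\<in>K. l k)"
  using assms
proof (induction K rule: finite_induct)
  case empty
  show ?case unfolding isLub_range_iff by simp
next
  case (insert k K)
  have "mono (\<lambda>n. \<Sum>k\<in>K. x k n)"
    using insert.prems(1) by (intro monoI sum_mono) (auto dest: monoD)
  then have "isLub UNIV (range (\<lambda>n. x k n + (\<Sum>k\<in>K. x k n))) (l k + (\<Sum>k\<in>K. l k))"
    using insert by (intro isLub_range_add) auto
  then show ?case
    using insert.hyps by simp
qed


section \<open>Regulators\<close>

lemma abs_diff_le_iff_le_add: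
  fixes x y :: "'a::lattice_ab_group_add_abs"
  shows "\<bar>x - y\<bar> \<le> s \<longleftrightarrow> x \<le> y + s \<and> y \<le> x + s"
proof -
  have "\<bar>x - y\<bar> \<le> s \<longleftrightarrow> x - y \<le> s \<and> - (x - y) \<le> s"
    using abs_ge_self[of "x - y"] abs_ge_minus_self[of "x - y"]
    by (metis abs_leI order_trans)
  then show ?thesis
    by (simp add: diff_le_eq add.commute)
qed

lemma D_sequence_nonneg: "D_sequence a \<Longrightarrow> 0 \<le> a i j"
  unfolding D_sequence_def isGlb_range_iff by blast

lemma D_sequence_decreasing: "D_sequence a \<Longrightarrow> a i j \<le> a i 0"
  unfolding D_sequence_def by (meson lift_Suc_antimono_le zero_le)

lemma weakly_sigma_distributive_le_0:
  fixes a :: "nat \<Rightarrow> nat \<Rightarrow> 'z::archimedean_riesz_space"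
  assumes "weakly_sigma_distributive TYPE('z)" "D_sequence a"
    and "\<And>\<phi>. D_sup a \<phi> (S \<phi>)" and "\<And>\<phi>. v \<le> S \<phi>"
  shows "v \<le> 0"
proof -
  have "isGlb UNIV (range S) 0"
    using assms(1-3) unfolding weakly_sigma_distributive_def by blast
  then show ?thesis
    using assms(4) unfolding isGlb_range_iff by blast
qed

locale sup_preserving =
  fixes T :: "'x::archimedean_riesz_space \<Rightarrow> 'z::archimedean_riesz_space"
  assumes linear_T: "linear T"
    and isLub_T: "\<And>us u. \<lbrakk>\<And>n::nat. 0 \<le> us n; isLub UNIV (range us) u\<rbrakk>
                     \<Longrightarrow> isLub UNIV (range (\<lambda>n. T (us n))) (T u)"
begin

text \<open>Positivity comes for free: a nonnegative \<open>x\<close> is the supremum of the sequence \<open>0, x, x, \<dots>\<close>,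
  whose image starts with \<open>0\<close>.\<close>

lemma mono_T: "mono T"
proof
  fix x y :: 'x
  assume le: "x \<le> y"
  let ?us = "\<lambda>n::nat. if n = 0 then 0 else y - x"
  have "isLub UNIV (range ?us) (y - x)"
    using le unfolding isLub_range_iff by auto
  then have "isLub UNIV (range (\<lambda>n. T (?us n))) (T (y - x))"
    using le by (intro isLub_T) auto
  then have "T (?us 0) \<le> T (y - x)"
    unfolding isLub_range_iff by blast
  then show "T x \<le> T y"
    using linear_T by (simp add: linear_0 linear_diff)
qed

lemma D_sequence_T:
  assumes "D_sequence a"
  shows "D_sequence (\<lambda>i j. T (a i j))"
  unfolding D_sequence_def
proof (intro conjI allI)
  fix i j
  show "T (a i (Suc j)) \<le> T (a i j)"
    using assms mono_T unfolding D_sequence_def by (auto dest: monoD)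
  \<comment> \<open>The infimum becomes the supremum of the nonnegative sequence \<open>a i 0 - a i j\<close>.\<close>
  have "isLub UNIV (range (\<lambda>j. a i 0 - a i j)) (a i 0)"
    using assms unfolding D_sequence_def isLub_range_diff_iff_isGlb by blast
  then have "isLub UNIV (range (\<lambda>j. T (a i 0 - a i j))) (T (a i 0))"
    using D_sequence_decreasing[OF assms] by (intro isLub_T) auto
  then show "isGlb UNIV (range (\<lambda>j. T (a i j))) 0"
    using linear_T by (simp add: linear_diff isLub_range_diff_iff_isGlb)
qed

lemma D_sup_T:
  assumes "D_sequence a" "D_sup a \<phi> s"
  shows "D_sup (\<lambda>i j. T (a i j)) \<phi> (T s)"
  using assms unfolding D_sup_def by (auto intro: isLub_T D_sequence_nonneg)

text \<open>The image of the limit is determined by the regulator even where the limit itself is not,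
  since the transported regulator lives in a weakly \<open>\<sigma>\<close>-distributive space.\<close>

lemma Lub_image_of_D_limit:
  fixes g :: "nat \<Rightarrow> 'x"
  assumes wsd: "weakly_sigma_distributive TYPE('z)"
    and "mono g" and a: "D_sequence a"
    and lim: "\<And>\<phi>. \<exists>s. D_sup a \<phi> s \<and> (\<exists>p. \<forall>n\<ge>p. \<bar>g n - l\<bar> \<le> s)"
  shows "isLub UNIV (range (\<lambda>n. T (g n))) (T l)"
proof -
  obtain S p where S: "\<And>\<phi>. D_sup a \<phi> (S \<phi>)"
    and p: "\<And>\<phi> n. p \<phi> \<le> n \<Longrightarrow> \<bar>g n - l\<bar> \<le> S \<phi>"
    using lim by metis
  note le_0 = weakly_sigma_distributive_le_0[OF wsd D_sequence_T[OF a] D_sup_T[OF a S]]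
  have upper: "T (g n) \<le> T l + T (S \<phi>)" if "p \<phi> \<le> n" for \<phi> n
  proof -
    have "g n \<le> l + S \<phi>"
      using p[OF that] by (simp add: abs_diff_le_iff_le_add)
    then have "T (g n) \<le> T (l + S \<phi>)"
      using mono_T by (rule monoD[rotated])
    then show ?thesis
      using linear_T by (simp add: linear_add)
  qed
  have lower: "T l \<le> T (g n) + T (S \<phi>)" if "p \<phi> \<le> n" for \<phi> n
  proof -
    have "l \<le> g n + S \<phi>"
      using p[OF that] by (simp add: abs_diff_le_iff_le_add)
    then have "T l \<le> T (g n + S \<phi>)"
      using mono_T by (rule monoD[rotated])
    then show ?thesis
      using linear_T by (simp add: linear_add)
  qed
  show ?thesis
    unfolding isLub_range_iff
  proof (intro conjI allI impI)
    fix n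
    have "T (g n) - T l \<le> T (S \<phi>)" for \<phi>
    proof -
      have "T (g n) \<le> T (g (max n (p \<phi>)))"
        using \<open>mono g\<close> mono_T by (simp add: monoD)
      also have "\<dots> \<le> T l + T (S \<phi>)"
        by (rule upper) simp
      finally show ?thesis
        by (simp add: diff_le_eq add.commute)
    qed
    from le_0[OF this] show "T (g n) \<le> T l"
      by simp
  next
    fix u assume u: "\<forall>n. T (g n) \<le> u"
    have "T l - u \<le> T (S \<phi>)" for \<phi>
    proof -
      have "T l \<le> T (g (p \<phi>)) + T (S \<phi>)"
        by (rule lower) simp
      also have "\<dots> \<le> u + T (S \<phi>)"
        using u by (simp add: add_right_mono)
      finally show ?thesis
        by (simp add: diff_le_eq add.commute)
    qed
    from le_0[OF this] show "T l \<le> u"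
      by simp
  qed
qed

end


section \<open>Passing to the supremum under a uniform regulator\<close>

lemma abs_diff_Lub_le:
  fixes x y :: "nat \<Rightarrow> 'a::archimedean_riesz_space"
  assumes x: "isLub UNIV (range x) l" and y: "isLub UNIV (range y) k"
    and d: "\<And>n. \<bar>x n - y n\<bar> \<le> s"
  shows "\<bar>l - k\<bar> \<le> s"
proof -
  have "x n \<le> k + s" "y n \<le> l + s" for n
  proof -
    have "x n \<le> y n + s" "y n \<le> x n + s"
      using d[of n] by (simp_all add: abs_diff_le_iff_le_add)
    moreover have "y n \<le> k" "x n \<le> l"
      using x y unfolding isLub_range_iff by auto
    ultimately show "x n \<le> k + s" "y n \<le> l + s"
      by (meson add_right_mono order_trans)+
  qed
  then have "l \<le> k + s" "k \<le> l + s"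
    using x y unfolding isLub_range_iff by blast+
  then show ?thesis
    by (simp add: abs_diff_le_iff_le_add)
qed

text \<open>In the application \<open>I n\<close> is the integral of the \<open>n\<close>-th function and \<open>R n \<gamma>\<close> its Riemann
  sum. One late \<open>\<gamma>\<close> bounds all \<open>I n\<close> at once, which gives \<open>I\<close> a supremum; then
  the estimate, being uniform in \<open>n\<close>, survives the passage to the suprema.\<close>

lemma regulates_Lub:
  fixes R :: "nat \<Rightarrow> 'i \<Rightarrow> 'z::archimedean_riesz_space"
  assumes sdc: "sigma_dedekind_complete TYPE('z)"
    and b: "D_sequence b"
    and unif: "\<And>\<phi>. \<exists>s. D_sup b \<phi> s \<and>
        (\<exists>\<gamma>0\<in>D. \<forall>\<gamma>\<in>D. le \<gamma>0 \<gamma> \<longrightarrow> (\<forall>n. \<bar>I n - R n \<gamma>\<bar> \<le> s))"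
    and R: "\<And>\<gamma>. \<gamma> \<in> D \<Longrightarrow> isLub UNIV (range (\<lambda>n. R n \<gamma>)) (r \<gamma>)"
    and refl: "\<And>\<gamma>. \<gamma> \<in> D \<Longrightarrow> le \<gamma> \<gamma>"
  obtains z where "isLub UNIV (range I) z" "D_regulates b D le r z"
proof -
  obtain s \<gamma>0 where "\<gamma>0 \<in> D" and s: "\<And>n. \<bar>I n - R n \<gamma>0\<bar> \<le> s"
    using unif refl by blast
  have "I n \<le> r \<gamma>0 + s" for n
  proof -
    have "I n \<le> R n \<gamma>0 + s"
      using s[of n] by (simp add: abs_diff_le_iff_le_add)
    also have "\<dots> \<le> r \<gamma>0 + s"
      using R[OF \<open>\<gamma>0 \<in> D\<close>] unfolding isLub_range_iff by (simp add: add_right_mono)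
    finally show ?thesis .
  qed
  then have "bdd_above (range I)"
    by (intro bdd_aboveI) auto
  then have "\<exists>z. isLub UNIV (range I) z"
    using sdc[unfolded sigma_dedekind_complete_def, rule_format, of "range I"] by simp
  then obtain z where z: "isLub UNIV (range I) z" ..
  have "D_regulates b D le r z"
    unfolding D_regulates_def
  proof (intro conjI allI b)
    fix \<phi>
    obtain s \<gamma>0 where "D_sup b \<phi> s" "\<gamma>0 \<in> D"
      and s: "\<And>\<gamma> n. \<lbrakk>\<gamma> \<in> D; le \<gamma>0 \<gamma>\<rbrakk> \<Longrightarrow> \<bar>I n - R n \<gamma>\<bar> \<le> s"
      using unif by meson
    moreover have "\<bar>r \<gamma> - z\<bar> \<le> s" if "\<gamma> \<in> D" "le \<gamma>0 \<gamma>" for \<gamma>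
      using abs_diff_Lub_le[OF z R s] that by (simp add: abs_minus_commute)
    ultimately show "\<exists>s. D_sup b \<phi> s \<and> (\<exists>\<gamma>0\<in>D. \<forall>\<gamma>\<in>D. le \<gamma>0 \<gamma> \<longrightarrow> \<bar>r \<gamma> - z\<bar> \<le> s)"
      by blast
  qed
  with z show thesis ..
qed

text \<open>The comparison is made at one partition that serves both functions at once; it costs
  \<open>2 s\<close>, which the infimum over \<open>\<phi>\<close> removes.\<close>

lemma le_of_uniform_D_approximation:
  fixes R :: "nat \<Rightarrow> 'i \<Rightarrow> 'z::archimedean_riesz_space"
  assumes wsd: "weakly_sigma_distributive TYPE('z)"
    and b: "D_sequence b"
    and unif: "\<And>\<phi>. \<exists>s. D_sup b \<phi> s \<and> (\<exists>\<gamma>\<in>D. \<forall>n. \<bar>I n - R n \<gamma>\<bar> \<le> s)"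
    and R: "\<And>\<gamma>. \<gamma> \<in> D \<Longrightarrow> R m \<gamma> \<le> R n \<gamma>"
  shows "I m \<le> I n"
proof -
  obtain S \<gamma> where S: "\<And>\<phi>. D_sup b \<phi> (S \<phi>)" and \<gamma>: "\<And>\<phi>. \<gamma> \<phi> \<in> D"
    and d: "\<And>\<phi> n. \<bar>I n - R n (\<gamma> \<phi>)\<bar> \<le> S \<phi>"
    using unif by metis
  have "(1/2) *\<^sub>R (I m - I n) \<le> S \<phi>" for \<phi>
  proof -
    have "I m \<le> R m (\<gamma> \<phi>) + S \<phi>" "R n (\<gamma> \<phi>) \<le> I n + S \<phi>"
      using d by (simp_all add: abs_diff_le_iff_le_add)
    then have 1: "I m - R m (\<gamma> \<phi>) \<le> S \<phi>" and 2: "R n (\<gamma> \<phi>) - I n \<le> S \<phi>"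
      by (simp_all add: diff_le_eq add.commute)
    have "I m - I n = (I m - R m (\<gamma> \<phi>)) + (R m (\<gamma> \<phi>) - I n)"
      by simp
    also have "\<dots> \<le> (I m - R m (\<gamma> \<phi>)) + (R n (\<gamma> \<phi>) - I n)"
      using R[OF \<gamma>] by (intro add_left_mono diff_right_mono)
    also have "\<dots> \<le> S \<phi> + S \<phi>"
      using 1 2 by (rule add_mono)
    finally have "(1/2) *\<^sub>R (I m - I n) \<le> (1/2) *\<^sub>R (S \<phi> + S \<phi>)"
      by (intro scaleR_left_mono) auto
    then show ?thesis
      by (simp add: scaleR_right_distrib flip: scaleR_left_distrib)
  qed
  from weakly_sigma_distributive_le_0[OF wsd b S this]
  have "2 *\<^sub>R ((1/2) *\<^sub>R (I m - I n)) \<le> 2 *\<^sub>R 0"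
    by (rule scaleR_left_mono) auto
  then show ?thesis
    by simp
qed

lemma o_lim_of_increasing:
  assumes "mono x" and "isLub UNIV (range x) l"
  shows "o_lim x l"
  unfolding o_lim_def
proof (intro exI conjI allI)
  show "decseq (\<lambda>n. l - x n)"
    using assms(1) by (auto simp: antimono_def mono_def intro: diff_left_mono)
  have "isLub UNIV (range (\<lambda>n. l - (l - x n))) l"
    using assms(2) by simp
  then show "isGlb UNIV (range (\<lambda>n. l - x n)) 0"
    unfolding isLub_range_diff_iff_isGlb .
  show "\<bar>x n - l\<bar> \<le> l - x n" for n
    using assms(2) unfolding isLub_range_iff
    by (metis abs_minus_commute abs_of_nonneg diff_ge_0_iff_ge order_refl)
qed


section \<open>Riemann sums and integrals in an integration structure\<close>

context po_integration_structure
begin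

lemma sup_preserving_prd:
  assumes "0 \<le> v"
  shows "sup_preserving (\<lambda>u. prd u v)"
proof (rule sup_preserving.intro)
  show "linear (\<lambda>u. prd u v)"
    using bilinear_prd by (simp add: bilinear_def)
qed (use assms in \<open>auto intro: sup_left\<close>)

lemma riemann_sum_mono:
  assumes "\<And>B. B \<in> \<H> \<Longrightarrow> 0 \<le> \<mu> B" "\<And>\<omega>. \<omega> \<in> \<Omega> \<Longrightarrow> g \<omega> \<le> h \<omega>"
    and "B \<in> \<H>" "\<gamma> \<in> Gam N B"
  shows "riemann_sum N prd \<mu> g B \<gamma> \<le> riemann_sum N prd \<mu> h B \<gamma>"
  unfolding riemann_sum_def
  using assms pset_in ptag_in
  by (intro sum_mono monoD[OF sup_preserving.mono_T[OF sup_preserving_prd]]) auto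

lemma isLub_riemann_sum:
  assumes wsd: "weakly_sigma_distributive TYPE('z)"
    and \<mu>: "\<And>B. B \<in> \<H> \<Longrightarrow> 0 \<le> \<mu> B"
    and incr: "\<And>m n \<omega>. \<lbrakk>m \<le> n; \<omega> \<in> \<Omega>\<rbrakk> \<Longrightarrow> fs m \<omega> \<le> fs n \<omega>"
    and cr: "common_regulator \<Omega> fs f"
    and B: "B \<in> \<H>" "\<gamma> \<in> Gam N B"
  shows "isLub UNIV (range (\<lambda>n. riemann_sum N prd \<mu> (fs n) B \<gamma>)) (riemann_sum N prd \<mu> f B \<gamma>)"
  unfolding riemann_sum_def
proof (rule isLub_range_sum)
  show "finite (idx N B \<gamma>)"
    using B by (rule finite_idx)
  fix k assume k: "k \<in> idx N B \<gamma>"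
  interpret sup_preserving "\<lambda>u. prd u (\<mu> (pset N B \<gamma> k))"
    using pset_in[OF B k] by (intro sup_preserving_prd \<mu>)
  let ?g = "\<lambda>n. fs n (ptag N B \<gamma> k)"
  have "mono ?g"
    using incr ptag_in[OF B k] by (intro monoI)
  then show "mono (\<lambda>n. prd (?g n) (\<mu> (pset N B \<gamma> k)))"
    using mono_T unfolding mono_def by blast
  obtain a where a: "D_sequence a"
    and lim: "\<And>\<phi>. \<exists>s. D_sup a \<phi> s \<and> (\<forall>\<omega>\<in>\<Omega>. \<exists>p. \<forall>n\<ge>p. \<bar>fs n \<omega> - f \<omega>\<bar> \<le> s)"
    using cr unfolding common_regulator_def by blast
  show "isLub UNIV (range (\<lambda>n. prd (?g n) (\<mu> (pset N B \<gamma> k))))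
          (prd (f (ptag N B \<gamma> k)) (\<mu> (pset N B \<gamma> k)))"
    by (rule Lub_image_of_D_limit[OF wsd \<open>mono ?g\<close> a]) (use lim ptag_in[OF B k] in blast)
qed

lemma net_integral_eqI:
  assumes "B \<in> \<H>" "has_net_integral N \<eta>3 prd \<mu> g B z"
  shows "net_integral N \<eta>3 prd \<mu> g B = z"
  unfolding net_integral_def
  using assms eta3.hausdorff[OF directed_Gam]
  unfolding has_net_integral_def by (intro the_equality) blast+

end


section \<open>The monotone convergence theorem\<close>

theorem theorem4p9:
  fixes \<Omega> :: "'w set"
    and \<H> :: "'w set set"
    and N :: "('w, 'i, 'k) tagged_nets"
    and \<eta>1 :: "('i, 'x::archimedean_riesz_space) net_convergence"
    and \<eta>2 :: "('i, 'y::archimedean_riesz_space) net_convergence"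
    and prd :: "'x \<Rightarrow> 'y \<Rightarrow> 'z::archimedean_riesz_space"
    and \<mu> :: "'w set \<Rightarrow> 'y"
    and fs :: "nat \<Rightarrow> 'w \<Rightarrow> 'x"
    and f :: "'w \<Rightarrow> 'x"
    and A :: "'w set"
  assumes "po_integration_structure \<Omega> \<H> N \<eta>1 \<eta>2 D_conv prd"
    and "sigma_dedekind_complete TYPE('z)"
    and "weakly_sigma_distributive TYPE('z)"
    and "\<And>B. B \<in> \<H> \<Longrightarrow> 0 \<le> \<mu> B"
    and "additive \<H> \<mu>"
    and "measure_adapted \<H> N \<mu>"
    and "\<And>m n \<omega>. \<lbrakk>m \<le> n; \<omega> \<in> \<Omega>\<rbrakk> \<Longrightarrow> fs m \<omega> \<le> fs n \<omega>"
    and "\<And>n. net_riemann_integrable \<H> N D_conv prd \<mu> (fs n)"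
    and "\<And>n. henstock_property \<H> N prd \<mu> (fs n)"
    and "uniformly_regulated_integrals \<H> N prd \<mu> fs"
    and "uniformly_approximable_integrals \<H> N prd \<mu> fs"
    and "common_regulator \<Omega> fs f"
    and "A \<in> \<H>"
    and "order_bounded (range (\<lambda>n. net_integral N D_conv prd \<mu> (fs n) A))"
  shows "net_riemann_integrable \<H> N D_conv prd \<mu> f
    \<and> o_lim (\<lambda>n. net_integral N D_conv prd \<mu> (fs n) A) (net_integral N D_conv prd \<mu> f A)
    \<and> isLub UNIV (range (\<lambda>n. net_integral N D_conv prd \<mu> (fs n) A)) (net_integral N D_conv prd \<mu> f A)"
proof -
  interpret po_integration_structure \<Omega> \<H> N \<eta>1 \<eta>2 D_conv prd
    by fact
  note \<mu> = assms(4) and incr = assms(7)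
  let ?I = "\<lambda>B n. net_integral N D_conv prd \<mu> (fs n) B"
  let ?R = "\<lambda>B n. riemann_sum N prd \<mu> (fs n) B"
  obtain b :: "nat \<Rightarrow> nat \<Rightarrow> 'z" where b: "D_sequence b"
    and unif: "\<And>B \<phi>. B \<in> \<H> \<Longrightarrow> \<exists>s. D_sup b \<phi> s \<and>
        (\<exists>\<gamma>0\<in>Gam N B. \<forall>\<gamma>\<in>Gam N B. leq N B \<gamma>0 \<gamma> \<longrightarrow> (\<forall>n. \<bar>?I B n - ?R B n \<gamma>\<bar> \<le> s))"
    using assms(11) unfolding uniformly_approximable_integrals_def by blast
  have refl: "leq N B \<gamma> \<gamma>" if "B \<in> \<H>" "\<gamma> \<in> Gam N B" for B \<gamma>
    using directed_Gam[OF that(1)] that(2) unfolding directed_set_def by (auto dest: reflp_onD)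
  have integral: "\<exists>z. isLub UNIV (range (?I B)) z \<and> has_net_integral N D_conv prd \<mu> f B z"
    if B: "B \<in> \<H>" for B
  proof -
    obtain z where "isLub UNIV (range (?I B)) z"
      "D_regulates b (Gam N B) (leq N B) (riemann_sum N prd \<mu> f B) z"
      using isLub_riemann_sum[OF assms(3) \<mu> incr assms(12) B] refl[OF B]
      by (rule regulates_Lub[OF assms(2) b unif[OF B]])
    then show ?thesis
      unfolding has_net_integral_def D_conv_def by blast
  qed
  have "mono (?I A)"
  proof
    fix m n :: nat assume "m \<le> n"
    show "?I A m \<le> ?I A n"
    proof (rule le_of_uniform_D_approximation[OF assms(3) b])
      show "\<exists>s. D_sup b \<phi> s \<and> (\<exists>\<gamma>\<in>Gam N A. \<forall>n. \<bar>?I A n - ?R A n \<gamma>\<bar> \<le> s)" for \<phi>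
        using unif[OF \<open>A \<in> \<H>\<close>, of \<phi>] refl[OF \<open>A \<in> \<H>\<close>] by blast
      show "?R A m \<gamma> \<le> ?R A n \<gamma>" if "\<gamma> \<in> Gam N A" for \<gamma>
        using \<mu> incr[OF \<open>m \<le> n\<close>] \<open>A \<in> \<H>\<close> that by (rule riemann_sum_mono)
    qed
  qed
  moreover have "isLub UNIV (range (?I A)) (net_integral N D_conv prd \<mu> f A)"
    using integral[OF \<open>A \<in> \<H>\<close>] net_integral_eqI[OF \<open>A \<in> \<H>\<close>] by metis
  moreover have "net_riemann_integrable \<H> N D_conv prd \<mu> f"
    using integral unfolding net_riemann_integrable_def net_integrable_on_def by blast
  ultimately show ?thesis
    using o_lim_of_increasing by blast
qed

end
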